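(* Let $\{Y(t),t\ge 0\}$ be an extremal process with homogeneous max-increments, with $Y(1)$ having distribution function $e^{-\xi(x)}$. Let $\{T(t),t\ge0\}$ be a gamma($\alpha,\beta$) process, $\alpha,\beta>0$, independent of $\{Y(t)\}$. Then the compound extremal process $X(t)=Y(T(t))$ is gamma-max-infinitely divisible; that is, with $\varphi(s)=\left(\frac{1}{1+\alpha s}\right)^{\beta}$ the Laplace transform of $T(1)$, for every $t>0$ the distribution function of $X(t)$ is $$P\{X(t)\le x\}=\{\varphi(\xi(x))\}^{t}.$$
   Context: An extremal process is a process with nondecreasing right-continuous sample paths and independent max-increments: for $0\le s<t$ there is a random variable $U(s,t)$, independent of $\{Y(r),r\le s\}$, with $Y(t)=\max(Y(s),U(s,t))$ almost surely. It has homogeneous max-increments when its one-dimensional distribution functions are $F_t(y)=P\{Y(t)\le y\}=\exp\{-t\,\xi(y)\}$ for $y\ge\lambda$ (and $0$ for $y<\lambda$) for $t>0$, where $\lambda>0$ is the bottom of the set $\{F>0\}$, $F=F_1$ is the distribution function of $Y(1)$, and $\xi(y)=-\log F(y)$ (in the notation of exponent measures, $\xi(y)=\mu[(\lambda,y)^c]$ with $\mu$ the exponent measure of $Y(1)$). Put $\xi(y)=\infty$ where $F(y)=0$, with $e^{-\infty}=0$ and $\varphi(\infty)=0$. A gamma($\alpha,\beta$) process is a non-negative process $\{T(t),t\ge0\}$ with $T(0)=0$, stationary, independent, additive increments, right-continuous nondecreasing paths, and Laplace transform $E[e^{-sT(t)}]=\varphi(s)^t$, $\varphi(s)=(1+\alpha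 s)^{-\beta}$, $s\ge 0$. For a Laplace transform $\varphi$, the compound process $X(t)=Y(T(t))$ is called $\varphi$-max-infinitely divisible ($\varphi$-max-ID) when its distribution functions are of the form $\{\varphi(\xi(x))\}^t$; gamma-max-ID means that $\varphi$ is the Laplace transform of a gamma distribution. *)

theory Defs
  imports "HOL-Probability.Probability"
begin

(* Extension of a function on [0,oo) to the point oo by the value 0; it serves both for
   e^{-oo} = 0 and for phi(oo) = 0. *)
definition ext0 :: "(real \<Rightarrow> real) \<Rightarrow> ereal \<Rightarrow> real" where
  "ext0 f u = (if u = \<infinity> then 0 else f (real_of_ereal u))"

definition dist_fun :: "'a measure \<Rightarrow> ('a \<Rightarrow> real) \<Rightarrow> real \<Rightarrow> real" where
  "dist_fun M Z = cdf (distr M borel Z)"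

(* xi = - log F, with value oo where F = 0. *)
definition exponent_fun :: "(real \<Rightarrow> real) \<Rightarrow> real \<Rightarrow> ereal" where
  "exponent_fun F y = (if F y = 0 then \<infinity> else ereal (- ln (F y)))"

(* The family (Z r, r in I) as a single random element of the product space over I. *)
definition path_map :: "real set \<Rightarrow> (real \<Rightarrow> 'a \<Rightarrow> real) \<Rightarrow> 'a \<Rightarrow> real \<Rightarrow> real" where
  "path_map I Z \<omega> = (\<lambda>r\<in>I. Z r \<omega>)"

definition monotone_rc_process :: "'a measure \<Rightarrow> (real \<Rightarrow> 'a \<Rightarrow> real) \<Rightarrow> bool" where
  "monotone_rc_process M Z \<longleftrightarrow>
     (\<forall>t\<ge>0. Z t \<in> borel_measurable M) \<and>
     (\<forall>\<omega>\<in>space M. mono_on {0..} (\<lambda>t. Z t \<omega>)) \<and>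
     (\<forall>\<omega>\<in>space M. \<forall>t\<ge>0. continuous (at_right t) (\<lambda>s. Z s \<omega>))"

definition extremal_process :: "'a measure \<Rightarrow> (real \<Rightarrow> 'a \<Rightarrow> real) \<Rightarrow> bool" where
  "extremal_process M Y \<longleftrightarrow>
     monotone_rc_process M Y \<and>
     (\<forall>s t. 0 \<le> s \<and> s < t \<longrightarrow>
        (\<exists>U\<in>borel_measurable M.
             prob_space.indep_set M
               (sets (vimage_algebra (space M) U borel))
               (sets (vimage_algebra (space M) (path_map {0..s} Y) (PiM {0..s} (\<lambda>_. borel)))) \<and>
             (AE \<omega> in M. Y t \<omega> = max (Y s \<omega>) (U \<omega>))))"

(* The bdd_below conjunct is needed because Inf of a set of reals that is not bounded below
   is unspecified. *)
definition homogeneous_max_increments :: "'a measure \<Rightarrow> (real \<Rightarrow> 'a \<Rightarrow> real) \<Rightarrow> bool" where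
  "homogeneous_max_increments M Y \<longleftrightarrow>
     (let F = dist_fun M (Y 1); \<xi> = exponent_fun F; l = Inf {y. 0 < F y} in
        bdd_below {y. 0 < F y} \<and> 0 < l \<and>
        (\<forall>t>0. \<forall>y. dist_fun M (Y t) y =
           (if l \<le> y then ext0 (\<lambda>u. exp (- u)) (ereal t * \<xi> y) else 0)))"

definition stationary_increments :: "'a measure \<Rightarrow> (real \<Rightarrow> 'a \<Rightarrow> real) \<Rightarrow> bool" where
  "stationary_increments M T \<longleftrightarrow>
     (\<forall>s\<ge>0. \<forall>t\<ge>0. \<forall>h\<ge>0.
        distr M borel (\<lambda>\<omega>. T (s + h) \<omega> - T s \<omega>) = distr M borel (\<lambda>\<omega>. T (t + h) \<omega> - T t \<omega>))"

definition independent_increments :: "'a measure \<Rightarrow> (real \<Rightarrow> 'a \<Rightarrow> real) \<Rightarrow> bool" where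
  "independent_increments M T \<longleftrightarrow>
     (\<forall>(n::nat) (\<tau> :: nat \<Rightarrow> real). 0 \<le> \<tau> 0 \<and> (\<forall>i<n. \<tau> i < \<tau> (Suc i)) \<longrightarrow>
        prob_space.indep_vars M (\<lambda>_. borel) (\<lambda>i \<omega>. T (\<tau> (Suc i)) \<omega> - T (\<tau> i) \<omega>) {..<n})"

definition laplace_transform :: "real measure \<Rightarrow> real \<Rightarrow> real" where
  "laplace_transform N s = (\<integral>x. exp (- s * x) \<partial>N)"

definition gamma_lt :: "real \<Rightarrow> real \<Rightarrow> real \<Rightarrow> real" where
  "gamma_lt \<alpha> \<beta> s = (1 / (1 + \<alpha> * s)) powr \<beta>"

definition gamma_process :: "'a measure \<Rightarrow> real \<Rightarrow> real \<Rightarrow> (real \<Rightarrow> 'a \<Rightarrow> real) \<Rightarrow> bool" where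
  "gamma_process M \<alpha> \<beta> T \<longleftrightarrow>
     monotone_rc_process M T \<and>
     (\<forall>t\<ge>0. \<forall>\<omega>\<in>space M. 0 \<le> T t \<omega>) \<and>
     (\<forall>\<omega>\<in>space M. T 0 \<omega> = 0) \<and>
     stationary_increments M T \<and> independent_increments M T \<and>
     (\<forall>t\<ge>0. \<forall>s\<ge>0. laplace_transform (distr M borel (T t)) s = gamma_lt \<alpha> \<beta> s powr t)"

definition independent_processes ::
    "'a measure \<Rightarrow> (real \<Rightarrow> 'a \<Rightarrow> real) \<Rightarrow> (real \<Rightarrow> 'a \<Rightarrow> real) \<Rightarrow> bool" where
  "independent_processes M Y T \<longleftrightarrow>
     prob_space.indep_var M (PiM {0..} (\<lambda>_. borel)) (path_map {0..} Y)
                            (PiM {0..} (\<lambda>_. borel)) (path_map {0..} T)"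

definition compound_process ::
    "(real \<Rightarrow> 'a \<Rightarrow> real) \<Rightarrow> (real \<Rightarrow> 'a \<Rightarrow> real) \<Rightarrow> real \<Rightarrow> 'a \<Rightarrow> real" where
  "compound_process Y T t \<omega> = Y (T t \<omega>) \<omega>"

(* Scale a, shape b. *)
definition gamma_distribution :: "real \<Rightarrow> real \<Rightarrow> real measure" where
  "gamma_distribution a b = density lborel
     (\<lambda>x. ennreal (if 0 < x then x powr (b - 1) * exp (- x / a) / (Gamma b * a powr b) else 0))"

definition phi_max_id ::
    "'a measure \<Rightarrow> (real \<Rightarrow> real) \<Rightarrow> (real \<Rightarrow> ereal) \<Rightarrow> (real \<Rightarrow> 'a \<Rightarrow> real) \<Rightarrow> bool" where
  "phi_max_id M \<phi> \<xi> X \<longleftrightarrow>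
     (\<forall>t>0. X t \<in> borel_measurable M \<and> (\<forall>x. dist_fun M (X t) x = ext0 \<phi> (\<xi> x) powr t))"

definition gamma_max_id ::
    "'a measure \<Rightarrow> (real \<Rightarrow> ereal) \<Rightarrow> (real \<Rightarrow> 'a \<Rightarrow> real) \<Rightarrow> bool" where
  "gamma_max_id M \<xi> X \<longleftrightarrow>
     (\<exists>a>0. \<exists>b>0. phi_max_id M (laplace_transform (gamma_distribution a b)) \<xi> X)"

end

theory Submission
  imports Defs "HOL-Real_Asymp.Real_Asymp"
begin

text \<open>
  Conditionally on the clock \<^term>\<open>T t\<close> taking the value \<open>r > 0\<close>, independence of the two
  processes gives \<open>X t\<close> the law of \<^term>\<open>Y r\<close>, and
  \<open>P (Y r \<le> x) = exp (- r * \<xi> x)\<close>. Averaging over the clock turns this into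
  \<open>E (exp (- \<xi> x * T t))\<close>, the Laplace transform of \<^term>\<open>T t\<close> at \<open>\<xi> x\<close>, which is
  \<open>(gamma_lt \<alpha> \<beta> (\<xi> x)) powr t\<close>.

  Two points need care. The map that evaluates a path at a random time is not measurable for the
  product \<open>\<sigma>\<close>-algebra on all functions of time, so the conditioning cannot be carried out on
  path space. It is carried out on the sample space instead, endowed with the \<open>\<sigma>\<close>-algebra
  generated by \<^term>\<open>Y\<close>: there right-continuity of the paths makes \<open>(\<omega>, r) \<mapsto> Y r \<omega>\<close> jointly
  measurable (\<open>right_continuous_process_jointly_measurable\<close>), and Fubini's theorem applies
  (\<open>independent_random_time_change\<close>).
  Secondly, the formula for the law of \<^term>\<open>Y r\<close> is available only for \<open>r > 0\<close>. The clock
  avoids \<open>0\<close> almost surely because its Laplace transform vanishes at infinity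
  (\<open>gamma_process_positive\<close>). This also settles the case \<open>\<xi> x = \<infinity>\<close>, where
  \<open>P (Y r \<le> x) = 0\<close> for all \<open>r > 0\<close>.

  That the law is max-infinitely divisible of gamma type then amounts to \<^const>\<open>gamma_lt\<close> being the
  Laplace transform of a gamma density, a scaled form of Euler's integral
  (\<open>laplace_transform_gamma_distribution\<close>).
\<close>

section \<open>Evaluating a process at an independent random time\<close>

text \<open>
  Rounding up strictly, \<open>\<lfloor>n * t\<rfloor> + 1\<close> instead of \<open>\<lceil>n * t\<rceil>\<close>, keeps every grid point above
  \<open>t\<close>, so right-continuity at \<open>t\<close> is enough to pass to the limit along the grid.
\<close>
lemma floor_grid_approximation_at_right:
  fixes t :: real
  shows "filterlim (\<lambda>n. (of_int \<lfloor>real (Suc n) * t\<rfloor> + 1) / real (Suc n)) (at_right t) sequentially"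
proof (rule tendsto_imp_filterlim_at_right)
  let ?q = "\<lambda>n. (of_int \<lfloor>real (Suc n) * t\<rfloor> + 1) / real (Suc n)"
  have lower: "t < ?q n" for n
    using floor_correct[of "real (Suc n) * t"] by (simp add: pos_less_divide_eq mult.commute)
  have upper: "?q n \<le> t + inverse (real (Suc n))" for n
  proof -
    have "?q n \<le> (real (Suc n) * t + 1) / real (Suc n)"
      using of_int_floor_le[of "real (Suc n) * t"] by (intro divide_right_mono) auto
    also have "\<dots> = t + inverse (real (Suc n))"
      by (simp only: add_divide_distrib) (simp add: inverse_eq_divide)
    finally show ?thesis .
  qed
  have "(\<lambda>n. t + inverse (real (Suc n))) \<longlonglongrightarrow> t"
    using tendsto_add[OF tendsto_const LIMSEQ_inverse_real_of_nat, of t] by simp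
  then show "?q \<longlonglongrightarrow> t"
    by (rule tendsto_sandwich[of "\<lambda>_. t", rotated 3])
       (use lower[THEN less_imp_le] upper in \<open>simp_all add: always_eventually del: of_nat_Suc\<close>)
  show "eventually (\<lambda>n. ?q n > t) sequentially"
    using lower by (simp add: always_eventually)
qed

text \<open>
  The process is the pointwise limit of processes that are constant in time on the cells of a grid;
  each of these is measurable because it involves only countably many of the \<open>Z t\<close>. The truncation
  \<open>max 0\<close> makes the statement total in the time argument while using \<open>Z\<close> at non-negative times
  only.
\<close>
lemma right_continuous_process_jointly_measurable:
  fixes Z :: "real \<Rightarrow> 'b \<Rightarrow> real"
  assumes meas: "\<And>t. 0 \<le> t \<Longrightarrow> Z t \<in> borel_measurable N"
    and rc: "\<And>\<omega> t. \<omega> \<in> space N \<Longrightarrow> 0 \<le> t \<Longrightarrow> continuous (at_right t) (\<lambda>s. Z s \<omega>)"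
  shows "(\<lambda>p. Z (max 0 (snd p)) (fst p)) \<in> borel_measurable (N \<Otimes>\<^sub>M borel)"
proof (rule borel_measurable_LIMSEQ_real)
  let ?g = "\<lambda>n (p :: 'b \<times> real). nat \<lfloor>real (Suc n) * max 0 (snd p)\<rfloor>"
  let ?f = "\<lambda>n k (p :: 'b \<times> real). Z ((real k + 1) / real (Suc n)) (fst p)"
  show "(\<lambda>p. ?f n (?g n p) p) \<in> borel_measurable (N \<Otimes>\<^sub>M borel)" for n
  proof (rule measurable_compose_countable'[where I = UNIV and f = "?f n" and g = "?g n"])
    show "?f n k \<in> borel_measurable (N \<Otimes>\<^sub>M borel)" for k
      by (rule measurable_compose[OF measurable_fst meas]) simp
    show "?g n \<in> measurable (N \<Otimes>\<^sub>M borel) (count_space UNIV)"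
      by measurable
  qed simp
  show "(\<lambda>n. ?f n (?g n p) p) \<longlonglongrightarrow> Z (max 0 (snd p)) (fst p)"
    if "p \<in> space (N \<Otimes>\<^sub>M borel)" for p
  proof -
    have "((\<lambda>s. Z s (fst p)) \<longlongrightarrow> Z (max 0 (snd p)) (fst p)) (at_right (max 0 (snd p)))"
      using rc[of "fst p" "max 0 (snd p)"] that
      by (auto simp: space_pair_measure continuous_within)
    from filterlim_compose[OF this floor_grid_approximation_at_right]
    show ?thesis by simp
  qed
qed

text \<open>
  Independence is phrased through generated \<open>\<sigma>\<close>-algebras because \<^const>\<open>prob_space.indep_var\<close>
  requires both variables to take values in the same type, which a sample point and a random time do not.
\<close>
lemma (in prob_space) joint_distr_of_indep_set:
  assumes indep: "indep_set (sets (vimage_algebra (space M) X N)) (sets (vimage_algebra (space M) V R))"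
    and X[measurable]: "random_variable N X" and V[measurable]: "random_variable R V"
  shows "distr M N X \<Otimes>\<^sub>M distr M R V = distr M (N \<Otimes>\<^sub>M R) (\<lambda>\<omega>. (X \<omega>, V \<omega>))"
proof (rule pair_measure_eqI)
  interpret X: prob_space "distr M N X" by (rule prob_space_distr) fact
  interpret V: prob_space "distr M R V" by (rule prob_space_distr) fact
  show "sigma_finite_measure (distr M N X)" by unfold_locales
  show "sigma_finite_measure (distr M R V)" by unfold_locales
  show "sets (distr M N X \<Otimes>\<^sub>M distr M R V) = sets (distr M (N \<Otimes>\<^sub>M R) (\<lambda>\<omega>. (X \<omega>, V \<omega>)))"
    by (simp cong: sets_pair_measure_cong)
  fix A B assume "A \<in> sets (distr M N X)" "B \<in> sets (distr M R V)"
  then have A[measurable]: "A \<in> sets N" and B[measurable]: "B \<in> sets R" by simp_all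
  have "prob ((X -` A \<inter> space M) \<inter> (V -` B \<inter> space M))
      = prob (X -` A \<inter> space M) * prob (V -` B \<inter> space M)"
    using indep A B by (simp add: indep_sets2_eq in_vimage_algebra)
  moreover have "(\<lambda>\<omega>. (X \<omega>, V \<omega>)) -` (A \<times> B) \<inter> space M = (X -` A \<inter> space M) \<inter> (V -` B \<inter> space M)"
    by auto
  ultimately show "emeasure (distr M N X) A * emeasure (distr M R V) B
      = emeasure (distr M (N \<Otimes>\<^sub>M R) (\<lambda>\<omega>. (X \<omega>, V \<omega>))) (A \<times> B)"
    by (simp add: emeasure_distr emeasure_eq_measure ennreal_mult' [symmetric])
qed

text \<open>
  Under the \<open>\<sigma>\<close>-algebra \<open>N\<close> generated by the paths of \<open>Y\<close>, the identity on the sample space is a random element independent of \<open>S\<close>. The joint law of \<open>(\<omega>, S \<omega>)\<close> on \<open>N \<Otimes> borel\<close> is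
  therefore a product, and the event \<open>Y r \<omega> \<le> x\<close>, a measurable set of pairs \<open>(\<omega>, r)\<close>, can be
  measured by slicing at fixed \<open>r\<close>.
\<close>
lemma (in prob_space) independent_random_time_change:
  fixes S :: "'a \<Rightarrow> real"
  assumes Y: "monotone_rc_process M Y"
    and S[measurable]: "S \<in> borel_measurable M"
    and indep: "indep_set
      (sets (vimage_algebra (space M) (path_map {0..} Y) (PiM {0..} (\<lambda>_. borel))))
      (sets (vimage_algebra (space M) S borel))"
    and nonneg: "\<And>\<omega>. \<omega> \<in> space M \<Longrightarrow> 0 \<le> S \<omega>"
  shows "(\<lambda>\<omega>. Y (S \<omega>) \<omega>) \<in> borel_measurable M"
    and "(\<lambda>\<omega>. dist_fun M (Y (S \<omega>)) x) \<in> borel_measurable M"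
    and "dist_fun M (\<lambda>\<omega>. Y (S \<omega>) \<omega>) x = expectation (\<lambda>\<omega>. dist_fun M (Y (S \<omega>)) x)"
proof -
  let ?P = "PiM {0..} (\<lambda>_. borel) :: (real \<Rightarrow> real) measure"
  define N where "N = vimage_algebra (space M) (path_map {0..} Y) ?P"
  have spN[simp]: "space N = space M" by (simp add: N_def)
  have path: "path_map {0..} Y \<in> measurable N ?P"
    unfolding N_def
    by (rule measurable_vimage_algebra1) (auto simp: path_map_def space_PiM)
  have YN: "Y t \<in> borel_measurable N" if "0 \<le> t" for t
    using measurable_compose[OF path measurable_component_singleton[of t "{0..}" "\<lambda>_. borel"]] that
    by (simp add: path_map_def)
  have YM[measurable]: "Y t \<in> borel_measurable M" if "0 \<le> t" for t
    using Y that by (simp add: monotone_rc_process_def)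
  have id[measurable]: "(\<lambda>\<omega>. \<omega>) \<in> measurable M N"
    using YM unfolding N_def path_map_def
    by (intro measurable_vimage_algebra2 measurable_restrict) auto
  let ?J = "\<lambda>p. Y (max 0 (snd p)) (fst p)"
  have J[measurable]: "?J \<in> borel_measurable (N \<Otimes>\<^sub>M borel)"
    using Y by (intro right_continuous_process_jointly_measurable YN)
      (auto simp: monotone_rc_process_def)
  have pair[measurable]: "(\<lambda>\<omega>. (\<omega>, S \<omega>)) \<in> measurable M (N \<Otimes>\<^sub>M borel)"
    by measurable
  have "(\<lambda>\<omega>. ?J (\<omega>, S \<omega>)) \<in> borel_measurable M"
    by (rule measurable_compose[OF pair J])
  then show X[measurable]: "(\<lambda>\<omega>. Y (S \<omega>) \<omega>) \<in> borel_measurable M"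
    by (rule measurable_cong[THEN iffD1, rotated]) (use nonneg in \<open>simp add: max_absorb2\<close>)
  let ?D = "distr M N (\<lambda>\<omega>. \<omega>)" and ?L = "distr M borel S"
  interpret D: prob_space ?D by (rule prob_space_distr) fact
  interpret L: prob_space ?L by (rule prob_space_distr) fact
  interpret DL: pair_prob_space ?D ?L ..
  have joint: "?D \<Otimes>\<^sub>M ?L = distr M (N \<Otimes>\<^sub>M borel) (\<lambda>\<omega>. (\<omega>, S \<omega>))"
  proof (rule joint_distr_of_indep_set)
    have "sets (vimage_algebra (space M) (\<lambda>\<omega>. \<omega>) N) = sets N"
      using sets_vimage_algebra2[of "\<lambda>\<omega>. \<omega>" "space M" N] sets.sets_into_space[of _ N]
      by (auto simp: Int_absorb2) (metis Int_absorb2)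
    then show "indep_set (sets (vimage_algebra (space M) (\<lambda>\<omega>. \<omega>) N)) (sets (vimage_algebra (space M) S borel))"
      using indep by (simp add: N_def)
  qed measurable
  define A where "A = {p \<in> space (N \<Otimes>\<^sub>M borel). ?J p \<le> x}"
  have A[measurable]: "A \<in> sets (N \<Otimes>\<^sub>M borel)" unfolding A_def by measurable
  have A': "A \<in> sets (?D \<Otimes>\<^sub>M ?L)" using A by (simp cong: sets_pair_measure_cong)
  have slice: "measure ?D ((\<lambda>\<omega>. (\<omega>, r)) -` A) = dist_fun M (Y r) x" if "0 \<le> r" for r
  proof -
    have "(\<lambda>\<omega>. (\<omega>, r)) -` A = {\<omega> \<in> space M. Y r \<omega> \<le> x}"
      using that by (auto simp: A_def space_pair_measure max_absorb2)
    moreover have "{\<omega> \<in> space N. Y r \<omega> \<le> x} \<in> sets N"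
      using YN[OF that] by measurable
    moreover have "{\<omega> \<in> space M. Y r \<omega> \<le> x} = Y r -` {..x} \<inter> space M" by auto
    ultimately show ?thesis using that
      by (simp add: dist_fun_def cdf_def measure_distr[OF id] measure_distr[OF YM] Int_absorb2)
  qed
  have m: "(\<lambda>r. measure ?D ((\<lambda>\<omega>. (\<omega>, r)) -` A)) \<in> borel_measurable ?L"
    using DL.measurable_emeasure_Pair2[OF A'] unfolding measure_def by measurable
  from m have "(\<lambda>\<omega>. measure ?D ((\<lambda>\<omega>'. (\<omega>', S \<omega>)) -` A)) \<in> borel_measurable M"
    by (intro measurable_compose[OF S]) simp
  then show "(\<lambda>\<omega>. dist_fun M (Y (S \<omega>)) x) \<in> borel_measurable M"
    by (rule measurable_cong[THEN iffD1, rotated]) (use slice nonneg in simp)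
  have "dist_fun M (\<lambda>\<omega>. Y (S \<omega>) \<omega>) x = measure (?D \<Otimes>\<^sub>M ?L) A"
    unfolding joint measure_distr[OF pair A] dist_fun_def cdf_def
    by (subst measure_distr[OF X])
       (auto simp: A_def space_pair_measure nonneg max_absorb2 intro!: arg_cong[where f = prob])
  also have "\<dots> = (\<integral>r. measure ?D ((\<lambda>\<omega>. (\<omega>, r)) -` A) \<partial>?L)"
  proof -
    have "emeasure (?D \<Otimes>\<^sub>M ?L) A = (\<integral>\<^sup>+r. emeasure ?D ((\<lambda>\<omega>. (\<omega>, r)) -` A) \<partial>?L)"
      by (rule DL.emeasure_pair_measure_alt2[OF A'])
    then show ?thesis
      using m by (simp add: measure_def[of "?D \<Otimes>\<^sub>M ?L"] D.emeasure_eq_measure integral_eq_nn_integral)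
  qed
  also have "\<dots> = expectation (\<lambda>\<omega>. measure ?D ((\<lambda>\<omega>'. (\<omega>', S \<omega>)) -` A))"
    using m by (intro integral_distr) simp_all
  also have "\<dots> = expectation (\<lambda>\<omega>. dist_fun M (Y (S \<omega>)) x)"
    by (intro Bochner_Integration.integral_cong refl slice nonneg)
  finally show "dist_fun M (\<lambda>\<omega>. Y (S \<omega>) \<omega>) x = expectation (\<lambda>\<omega>. dist_fun M (Y (S \<omega>)) x)" .
qed

section \<open>The gamma distribution and the gamma process\<close>

text \<open>
  The exponential tilt \<open>exp (- s * x)\<close> changes the rate \<open>1 / a\<close> of the density into
  \<open>c = s + 1 / a\<close>, and the substitution \<open>x \<mapsto> c * x\<close> leads back to Euler's integral for
  \<^term>\<open>Gamma b\<close>.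
\<close>
lemma laplace_transform_gamma_distribution:
  assumes a: "0 < a" and b: "0 < b" and s: "0 \<le> s"
  shows "laplace_transform (gamma_distribution a b) s = gamma_lt a b s"
proof -
  define c where "c = s + 1 / a"
  have c: "0 < c" using a s by (simp add: c_def add_nonneg_pos)
  have G: "0 < Gamma b" using b by (rule Gamma_real_pos)
  let ?d = "\<lambda>x. if 0 < x then x powr (b - 1) * exp (- x / a) / (Gamma b * a powr b) else 0"
  let ?g = "\<lambda>t::real. indicator {0..} t * t powr (b - 1) / exp t"
  have scale: "?d x * exp (- s * x) = ?g (c * x) / (c powr (b - 1) * Gamma b * a powr b)" for x
  proof (cases "0 < x")
    case True
    have "?d x * exp (- s * x)
        = x powr (b - 1) * (exp (- x / a) * exp (- s * x)) / (Gamma b * a powr b)"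
      using True by simp
    also have "exp (- x / a) * exp (- s * x) = 1 / exp (c * x)"
      by (simp add: c_def exp_add [symmetric] exp_minus [symmetric] divide_inverse algebra_simps)
    finally show ?thesis using True c
      by (simp add: powr_mult indicator_def)
  next
    case False
    then show ?thesis using c by (auto simp: indicator_def zero_le_mult_iff)
  qed
  have "laplace_transform (gamma_distribution a b) s
      = (\<integral>x. ?g (c * x) / (c powr (b - 1) * Gamma b * a powr b) \<partial>lborel)"
    unfolding laplace_transform_def gamma_distribution_def scale [symmetric]
    using G by (subst integral_real_density) auto
  also have "\<dots> = (\<integral>x. ?g (0 + c * x) \<partial>lborel) / (c powr (b - 1) * Gamma b * a powr b)"
    by (simp only: add_0 integral_divide_zero)
  also have "(\<integral>x. ?g (0 + c * x) \<partial>lborel) = (\<integral>x. ?g x \<partial>lborel) / c"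
    using lborel_integral_real_affine[of c ?g 0] c by simp
  also have "(\<integral>x. ?g x \<partial>lborel) = Gamma b"
    using Gamma_conv_nn_integral_real[OF b, symmetric] G
    by (subst integral_eq_nn_integral) auto
  also have "Gamma b / c / (c powr (b - 1) * Gamma b * a powr b) = 1 / (a * c) powr b"
    using G c a by (simp add: powr_mult powr_diff field_simps)
  also have "a * c = 1 + a * s" using a by (simp add: c_def field_simps)
  also have "1 / (1 + a * s) powr b = gamma_lt a b s"
    using a s by (simp add: gamma_lt_def powr_divide)
  finally show ?thesis .
qed

lemma gamma_lt_tendsto_0:
  assumes "0 < \<alpha>" "0 < \<beta>"
  shows "(gamma_lt \<alpha> \<beta> \<longlongrightarrow> 0) at_top"
proof -
  have "((\<lambda>s. (1 + \<alpha> * s) powr - \<beta>) \<longlongrightarrow> 0) at_top"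
    using assms by real_asymp
  moreover have "eventually (\<lambda>s. (1 + \<alpha> * s) powr - \<beta> = gamma_lt \<alpha> \<beta> s) at_top"
    using eventually_ge_at_top[of 0]
    by eventually_elim (use assms in \<open>simp add: gamma_lt_def powr_divide powr_minus field_simps\<close>)
  ultimately show ?thesis by (rule Lim_transform_eventually)
qed

lemma (in prob_space) prob_zero_le_laplace_transform:
  assumes S[measurable]: "S \<in> borel_measurable M"
    and nonneg: "\<And>\<omega>. \<omega> \<in> space M \<Longrightarrow> 0 \<le> S \<omega>" and s: "0 \<le> s"
  shows "prob {\<omega> \<in> space M. S \<omega> = 0} \<le> laplace_transform (distr M borel S) s"
proof -
  have "prob {\<omega> \<in> space M. S \<omega> = 0} = expectation (indicator {\<omega> \<in> space M. S \<omega> = 0})"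
    by simp
  also have "\<dots> \<le> expectation (\<lambda>\<omega>. exp (- s * S \<omega>))"
  proof (rule integral_mono)
    show "integrable M (\<lambda>\<omega>. exp (- s * S \<omega>))"
      by (rule integrable_const_bound[where B = 1]) (use nonneg s in auto)
  qed (auto simp: indicator_def less_top [symmetric] intro!: integrable_real_indicator)
  also have "\<dots> = laplace_transform (distr M borel S) s"
    by (simp add: laplace_transform_def integral_distr)
  finally show ?thesis .
qed

text \<open>
  The atom of \<^term>\<open>T t\<close> at \<open>0\<close> is bounded by the Laplace transform at every \<open>s \<ge> 0\<close>, and
  \<open>(1 + \<alpha> * s) powr (- \<beta> * t)\<close> tends to \<open>0\<close> as \<open>s\<close> grows.
\<close>
lemma (in prob_space) gamma_process_positive:
  assumes T: "gamma_process M \<alpha> \<beta> T" and "0 < \<alpha>" "0 < \<beta>" "0 < t"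
  shows "AE \<omega> in M. 0 < T t \<omega>"
proof -
  have meas[measurable]: "T t \<in> borel_measurable M"
    and nonneg: "\<And>\<omega>. \<omega> \<in> space M \<Longrightarrow> 0 \<le> T t \<omega>"
    and lt: "\<And>s. 0 \<le> s \<Longrightarrow> laplace_transform (distr M borel (T t)) s = gamma_lt \<alpha> \<beta> s powr t"
    using T \<open>0 < t\<close> by (auto simp: gamma_process_def monotone_rc_process_def)
  have "((\<lambda>s. gamma_lt \<alpha> \<beta> s powr t) \<longlongrightarrow> 0 powr t) at_top"
    using assms by (intro tendsto_powr' gamma_lt_tendsto_0 tendsto_const)
      (auto simp: gamma_lt_def intro!: always_eventually)
  moreover have "eventually (\<lambda>s. prob {\<omega> \<in> space M. T t \<omega> = 0} \<le> gamma_lt \<alpha> \<beta> s powr t) at_top"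
    using eventually_ge_at_top[of 0]
    by eventually_elim (use prob_zero_le_laplace_transform[OF meas nonneg] lt in auto)
  ultimately have "prob {\<omega> \<in> space M. T t \<omega> = 0} \<le> 0 powr t"
    by (intro tendsto_lowerbound) auto
  then have "prob {\<omega> \<in> space M. T t \<omega> = 0} = 0"
    using measure_nonneg[of M] by (simp add: antisym)
  then have "AE \<omega> in M. T t \<omega> \<noteq> 0"
    by (subst (asm) prob_eq_0) auto
  then show ?thesis
    using nonneg by (auto elim!: AE_mp intro!: AE_I2 simp: less_le)
qed

section \<open>The compound process\<close>

text \<open>
  Below the bottom \<open>l\<close> of the set where the distribution function is positive, homogeneity
  prescribes the value \<open>0\<close> at every positive time; the instance at time \<open>1\<close> shows that then \<open>\<xi> x = \<infinity>\<close>. The case split at \<open>l\<close> is thus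
  absorbed by the one on whether \<open>\<xi> x\<close> is finite.
\<close>
lemma (in prob_space) homogeneous_dist_fun_cases:
  assumes "homogeneous_max_increments M Y" and Y1: "Y 1 \<in> borel_measurable M"
  defines "\<xi> \<equiv> exponent_fun (dist_fun M (Y 1))"
  obtains (inf) "\<xi> x = \<infinity>" "\<And>r. 0 < r \<Longrightarrow> dist_fun M (Y r) x = 0"
    | (fin) u where "0 \<le> u" "\<xi> x = ereal u" "\<And>r. 0 < r \<Longrightarrow> dist_fun M (Y r) x = exp (- u * r)"
proof -
  let ?F = "dist_fun M (Y 1)" and ?l = "Inf {y. 0 < dist_fun M (Y 1) y}"
  have F: "dist_fun M (Y r) x = (if ?l \<le> x then ext0 (\<lambda>u. exp (- u)) (ereal r * \<xi> x) else 0)"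
    if "0 < r" for r
    using assms(1) that unfolding homogeneous_max_increments_def Let_def \<xi>_def by blast
  interpret D: prob_space "distr M borel (Y 1)" by (rule prob_space_distr) fact
  have le1: "?F x \<le> 1" and ge0: "0 \<le> ?F x" by (simp_all add: dist_fun_def cdf_def)
  show thesis
  proof (cases "?F x = 0")
    case True
    then have "\<xi> x = \<infinity>" by (simp add: \<xi>_def exponent_fun_def)
    with F show thesis by (intro inf) (auto simp: ext0_def)
  next
    case False
    then have l: "?l \<le> x" using F[of 1] by (auto split: if_splits)
    have \<xi>: "\<xi> x = ereal (- ln (?F x))" using False by (simp add: \<xi>_def exponent_fun_def)
    show thesis
    proof (rule fin[OF _ \<xi>])
      show "0 \<le> - ln (?F x)" using False le1 ge0 by simp
      fix r :: real assume r: "0 < r"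
      have "dist_fun M (Y r) x = ext0 (\<lambda>u. exp (- u)) (ereal r * ereal (- ln (?F x)))"
        using F[OF r] l by (simp only: if_True \<xi>)
      also have "\<dots> = exp (- (- ln (?F x)) * r)"
        by (simp add: ext0_def mult.commute)
      finally show "dist_fun M (Y r) x = exp (- (- ln (?F x)) * r)" .
    qed
  qed
qed

lemma (in prob_space) gamma_compound_dist_fun:
  assumes Y: "monotone_rc_process M Y" and hom: "homogeneous_max_increments M Y"
    and pos: "0 < \<alpha>" "0 < \<beta>" and T: "gamma_process M \<alpha> \<beta> T"
    and indep: "independent_processes M Y T" and t: "0 < t"
  shows "compound_process Y T t \<in> borel_measurable M"
    and "dist_fun M (compound_process Y T t) x
      = ext0 (gamma_lt \<alpha> \<beta>) (exponent_fun (dist_fun M (Y 1)) x) powr t"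
proof -
  let ?P = "PiM {0..} (\<lambda>_. borel) :: (real \<Rightarrow> real) measure"
  have nonneg: "\<And>\<omega>. \<omega> \<in> space M \<Longrightarrow> 0 \<le> T t \<omega>" and T_meas[measurable]: "T t \<in> borel_measurable M"
    and lt: "\<And>s. 0 \<le> s \<Longrightarrow> laplace_transform (distr M borel (T t)) s = gamma_lt \<alpha> \<beta> s powr t"
    using T t by (auto simp: gamma_process_def monotone_rc_process_def)
  have Y1: "Y 1 \<in> borel_measurable M" using Y by (simp add: monotone_rc_process_def)
  have indT: "indep_set (sets (vimage_algebra (space M) (path_map {0..} Y) ?P))
      (sets (vimage_algebra (space M) (path_map {0..} T) ?P))"
    using indep by (simp add: independent_processes_def indep_var_eq sets_vimage_algebra)
  have sub: "sets (vimage_algebra (space M) (T t) borel) \<subseteq> sets (vimage_algebra (space M) (path_map {0..} T) ?P)"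
  proof -
    have "path_map {0..} T \<in> measurable (vimage_algebra (space M) (path_map {0..} T) ?P) ?P"
      by (rule measurable_vimage_algebra1) (auto simp: path_map_def space_PiM)
    from measurable_compose[OF this measurable_component_singleton[of t]]
    have "T t \<in> borel_measurable (vimage_algebra (space M) (path_map {0..} T) ?P)"
      using t by (simp add: path_map_def)
    from measurable_sets[OF this] show ?thesis
      by (simp add: sets_vimage_algebra2 image_subset_iff) blast
  qed
  have ind: "indep_set (sets (vimage_algebra (space M) (path_map {0..} Y) ?P))
      (sets (vimage_algebra (space M) (T t) borel))"
    using indT sub by (simp only: indep_sets2_eq) (meson subset_iff)
  have comp: "compound_process Y T t = (\<lambda>\<omega>. Y (T t \<omega>) \<omega>)"
    by (simp add: compound_process_def fun_eq_iff)
  show "compound_process Y T t \<in> borel_measurable M"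
    unfolding comp by (rule independent_random_time_change(1)[OF Y T_meas ind]) (rule nonneg)
  have mixture_meas: "(\<lambda>\<omega>. dist_fun M (Y (T t \<omega>)) x) \<in> borel_measurable M"
    by (rule independent_random_time_change(2)[OF Y T_meas ind]) (rule nonneg)
  have mixture: "dist_fun M (compound_process Y T t) x = expectation (\<lambda>\<omega>. dist_fun M (Y (T t \<omega>)) x)"
    unfolding comp by (rule independent_random_time_change(3)[OF Y T_meas ind]) (rule nonneg)
  have Tpos: "AE \<omega> in M. 0 < T t \<omega>" using T pos t by (rule gamma_process_positive)
  show "dist_fun M (compound_process Y T t) x
      = ext0 (gamma_lt \<alpha> \<beta>) (exponent_fun (dist_fun M (Y 1)) x) powr t"
  proof (cases rule: homogeneous_dist_fun_cases[OF hom Y1, of x, case_names inf fin])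
    case inf
    have "expectation (\<lambda>\<omega>. dist_fun M (Y (T t \<omega>)) x) = 0"
      using Tpos by (intro integral_eq_zero_AE) (auto simp: inf(2))
    then have "dist_fun M (compound_process Y T t) x = 0"
      unfolding mixture .
    then show ?thesis by (simp add: inf(1) ext0_def)
  next
    case (fin u)
    have "expectation (\<lambda>\<omega>. dist_fun M (Y (T t \<omega>)) x) = expectation (\<lambda>\<omega>. exp (- u * T t \<omega>))"
    proof (rule Bochner_Integration.integral_cong_AE)
      show "(\<lambda>\<omega>. dist_fun M (Y (T t \<omega>)) x) \<in> borel_measurable M" by (rule mixture_meas)
      show "AE \<omega> in M. dist_fun M (Y (T t \<omega>)) x = exp (- u * T t \<omega>)"
        using Tpos by eventually_elim (rule fin(3))
    qed measurable
    also have "\<dots> = laplace_transform (distr M borel (T t)) u"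
      by (simp add: laplace_transform_def integral_distr)
    also have "\<dots> = gamma_lt \<alpha> \<beta> u powr t" using fin(1) by (rule lt)
    finally have "dist_fun M (compound_process Y T t) x = gamma_lt \<alpha> \<beta> u powr t"
      unfolding mixture .
    then show ?thesis by (simp add: fin(2) ext0_def)
  qed
qed

theorem theorem3p1:
  fixes M :: "'a measure" and Y T :: "real \<Rightarrow> 'a \<Rightarrow> real" and \<xi> :: "real \<Rightarrow> ereal"
    and \<alpha> \<beta> :: real
  assumes "prob_space M"
    and "extremal_process M Y" and "homogeneous_max_increments M Y"
    and "\<xi> = exponent_fun (dist_fun M (Y 1))"
    and "0 < \<alpha>" and "0 < \<beta>" and "gamma_process M \<alpha> \<beta> T"
    and "independent_processes M Y T"
  shows "gamma_max_id M \<xi> (compound_process Y T) \<and>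
    (\<forall>s\<ge>0. laplace_transform (distr M borel (T 1)) s = gamma_lt \<alpha> \<beta> s) \<and>
    (\<forall>t>0. \<forall>x. measure M {\<omega> \<in> space M. compound_process Y T t \<omega> \<le> x}
       = ext0 (gamma_lt \<alpha> \<beta>) (\<xi> x) powr t)"
proof -
  interpret prob_space M by fact
  have Y: "monotone_rc_process M Y" using assms(2) by (simp add: extremal_process_def)
  then have Y1: "Y 1 \<in> borel_measurable M" by (simp add: monotone_rc_process_def)
  note X = gamma_compound_dist_fun[OF Y assms(3,5,6,7,8)]
  have lap: "ext0 (laplace_transform (gamma_distribution \<alpha> \<beta>)) (\<xi> x) = ext0 (gamma_lt \<alpha> \<beta>) (\<xi> x)" for x
  proof (cases rule: homogeneous_dist_fun_cases[OF assms(3) Y1, of x, case_names inf fin])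
    case inf
    then show ?thesis by (simp add: assms(4) ext0_def)
  next
    case (fin u)
    from fin(1,2) show ?thesis
      by (simp add: assms(4) ext0_def laplace_transform_gamma_distribution[OF assms(5,6)])
  qed
  have "phi_max_id M (laplace_transform (gamma_distribution \<alpha> \<beta>)) \<xi> (compound_process Y T)"
    unfolding phi_max_id_def
  proof (intro conjI allI impI)
    fix t x :: real assume t: "0 < t"
    show "compound_process Y T t \<in> borel_measurable M" by (rule X(1)[OF t])
    show "dist_fun M (compound_process Y T t) x
        = ext0 (laplace_transform (gamma_distribution \<alpha> \<beta>)) (\<xi> x) powr t"
      using X(2)[OF t, of x] unfolding lap[of x] assms(4)[symmetric] .
  qed
  then have "gamma_max_id M \<xi> (compound_process Y T)"
    using assms(5,6) unfolding gamma_max_id_def by blast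
  moreover have "laplace_transform (distr M borel (T 1)) s = gamma_lt \<alpha> \<beta> s" if "0 \<le> s" for s
    using assms(7) that by (simp add: gamma_process_def gamma_lt_def)
  moreover have "measure M {\<omega> \<in> space M. compound_process Y T t \<omega> \<le> x}
      = ext0 (gamma_lt \<alpha> \<beta>) (\<xi> x) powr t" if "0 < t" for t x
  proof -
    have "{\<omega> \<in> space M. compound_process Y T t \<omega> \<le> x} = compound_process Y T t -` {..x} \<inter> space M"
      by auto
    then have "measure M {\<omega> \<in> space M. compound_process Y T t \<omega> \<le> x} = dist_fun M (compound_process Y T t) x"
      by (simp add: dist_fun_def cdf_def measure_distr[OF X(1)[OF that]])
    also have "\<dots> = ext0 (gamma_lt \<alpha> \<beta>) (\<xi> x) powr t"
      unfolding assms(4) by (rule X(2)[OF that])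
    finally show ?thesis .
  qed
  ultimately show ?thesis by blast
qed

end
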